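(* Let $\alpha_0$ be a norm on $V$. Assume the orbit $G\alpha_0$ is bounded for $d_\infty$ and put $$D=\operatorname{diam}(G\alpha_0)=\sup_{g\in G}d_\infty(\alpha_0,g\alpha_0).$$ Let $\alpha_G(v)=\sup_{g\in G}\alpha_0(g^{-1}v)$ $(v\in V)$, a $G$-invariant norm in $\mathscr N_{\alpha_0}(V)$. Then $$\alpha_*=e^{-D/2}\alpha_G$$ is $G$-invariant and $$\inf_{\beta\in\mathscr N_{\alpha_0}(V)^G}d_\infty(\alpha_0,\beta)=d_\infty(\alpha_0,\alpha_* )=\frac D2,$$ where $\mathscr N_{\alpha_0}(V)^G$ is the set of $G$-invariant norms in $\mathscr N_{\alpha_0}(V)$.
   Context: Let $F$ and $E$ be finite extensions of $\mathbb Q_p$, with a fixed (non-Archimedean, nontrivial) absolute value $|\cdot|$ on $E$. Let $\mathbb G$ be a reductive group over $F$ and $G=\mathbb G(F)$. Let $\pi_{\mathrm{sm}}$ be a smooth admissible $E$-representation of $G$, let $\sigma_{\mathrm{alg}}$ be a finite-dimensional algebraic $E$-representation of $\operatorname{Res}_{F/\mathbb Q_p}\mathbb G$ (viewed as a representation of $G$), and put $V=\pi_{\mathrm{sm}}\otimes_E\sigma_{\mathrm{alg}}$ with the diagonal $G$-action. A norm on $V$ is a function $\alpha:V\to\mathbb R_{\ge0}$ with $\alpha(\lambda v)=|\lambda|\alpha(v)$, $\alpha(v+w)\le\max\{\alpha(v),\alpha(w)\}$ for $\lambda\in E$, $v,w\in V$, and $\alpha(v)=0\Rightarrow v=0$.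 For norms $\alpha,\beta$ put $d_\infty(\alpha,\beta)=\sup_{v\in V\setminus\{0\}}\left|\log\frac{\alpha(v)}{\beta(v)}\right|\in[0,+\infty]$ (an extended metric). The finite-distance component of $\alpha_0$ is $\mathscr N_{\alpha_0}(V)=\{\alpha:\ d_\infty(\alpha,\alpha_0)<\infty\}$. The group $G$ acts on norms by $(g\alpha)(v)=\alpha(g^{-1}v)$; a norm is $G$-invariant if $g\alpha=\alpha$ for all $g\in G$. The orbit $G\alpha_0$ is bounded if $\sup_{g\in G}d_\infty(\alpha_0,g\alpha_0)<\infty$. *)

theory Defs
  imports
    "HOL-Algebra.Algebraic_Closure_Type"
    "HOL-Library.Poly_Mapping"
    "HOL-Analysis.Analysis"
begin

section \<open>The fields\<close>

definition field_hom :: "('a::field \<Rightarrow> 'b::field) \<Rightarrow> bool" where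
  "field_hom h \<longleftrightarrow> h 1 = 1 \<and> (\<forall>x y. h (x + y) = h x + h y) \<and> (\<forall>x y. h (x * y) = h x * h y)"

definition finite_basis :: "('a::field \<Rightarrow> 'b::ab_group_add \<Rightarrow> 'b) \<Rightarrow> 'b set \<Rightarrow> bool" where
  "finite_basis scl B \<longleftrightarrow>
     finite B \<and> \<not> module.dependent scl B \<and> module.span scl B = UNIV"

text \<open>A field extension is given by its embedding; this is the induced vector space structure.\<close>

definition ext_scale :: "('a::field \<Rightarrow> 'b::field) \<Rightarrow> 'a \<Rightarrow> 'b \<Rightarrow> 'b" where
  "ext_scale h a x = h a * x"

definition finite_extension :: "('a::field \<Rightarrow> 'b::field) \<Rightarrow> bool" where
  "finite_extension h \<longleftrightarrow> field_hom h \<and> (\<exists>B. finite_basis (ext_scale h) B)"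

definition nonarch_abs :: "('a::field \<Rightarrow> real) \<Rightarrow> bool" where
  "nonarch_abs a \<longleftrightarrow> (\<forall>x. 0 \<le> a x) \<and> (\<forall>x. a x = 0 \<longleftrightarrow> x = 0) \<and>
     (\<forall>x y. a (x * y) = a x * a y) \<and> (\<forall>x y. a (x + y) \<le> max (a x) (a y))"

definition nontrivial_abs :: "('a::field \<Rightarrow> real) \<Rightarrow> bool" where
  "nontrivial_abs a \<longleftrightarrow> (\<exists>x. x \<noteq> 0 \<and> a x \<noteq> 1)"

definition rat_padic_abs :: "nat \<Rightarrow> rat \<Rightarrow> real" where
  "rat_padic_abs p r = (if r = 0 then 0 else
     real p powi (int (multiplicity (int p) (snd (quotient_of r)))
                - int (multiplicity (int p) (fst (quotient_of r)))))"

text \<open>The field \<open>\<rat>\<^sub>p\<close> with its absolute value, as the completion of \<open>(\<rat>, |\<cdot>|\<^sub>p)\<close>; this determines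
  it up to a unique isometric isomorphism.\<close>

definition is_padic_field :: "nat \<Rightarrow> ('q::field_char_0 \<Rightarrow> real) \<Rightarrow> bool" where
  "is_padic_field p a \<longleftrightarrow> Factorial_Ring.prime p \<and> nonarch_abs a \<and>
     (\<forall>r. a (of_rat r) = rat_padic_abs p r) \<and>
     Metric_space.mcomplete UNIV (\<lambda>x y. a (x - y)) \<and>
     Metric_space.mtopology UNIV (\<lambda>x y. a (x - y)) closure_of range of_rat = UNIV"


section \<open>Polynomials in several variables and linear algebraic groups\<close>

type_synonym ('i, 'a) mvpoly = "('i \<Rightarrow>\<^sub>0 nat) \<Rightarrow>\<^sub>0 'a"

text \<open>Evaluation at \<open>x\<close> after applying \<open>h\<close> to the coefficients.\<close>

definition mv_eval :: "('a::field \<Rightarrow> 'b::field) \<Rightarrow> ('i \<Rightarrow> 'b) \<Rightarrow> ('i, 'a) mvpoly \<Rightarrow> 'b" where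
  "mv_eval h x f =
     (\<Sum>m\<in>Poly_Mapping.keys f. h (Poly_Mapping.lookup f m) *
        (\<Prod>i\<in>Poly_Mapping.keys m. x i ^ Poly_Mapping.lookup m i))"

definition entries :: "'a^'n^'n \<Rightarrow> 'n \<times> 'n \<Rightarrow> 'a" where
  "entries A = (\<lambda>(i, j). A $ i $ j)"

text \<open>For a set \<open>S\<close> of polynomials over a field \<open>k\<close> in the matrix entries and \<open>h : k \<rightarrow> K\<close>, the
  \<open>K\<close>-points of the closed subscheme of \<open>GL\<^sub>n\<close> cut out by \<open>S\<close>. For \<open>h\<close> not an inclusion this gives
  the points of the conjugate of this scheme by \<open>h\<close>.\<close>

definition group_points ::
  "('a::field \<Rightarrow> 'b::field) \<Rightarrow> ('n::finite \<times> 'n, 'a) mvpoly set \<Rightarrow> ('b^'n^'n) set" where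
  "group_points h S = {A. invertible A \<and> (\<forall>f\<in>S. mv_eval h (entries A) f = 0)}"

definition matrix_group :: "('a::field^'n^'n) set \<Rightarrow> bool" where
  "matrix_group H \<longleftrightarrow> (\<forall>A\<in>H. invertible A) \<and> mat 1 \<in> H \<and>
     (\<forall>A\<in>H. \<forall>B\<in>H. A ** B \<in> H) \<and> (\<forall>A\<in>H. matrix_inv A \<in> H)"

definition zariski :: "('k::field^'n^'n) topology" where
  "zariski = topology_generated_by
     (range (\<lambda>f. {A. mv_eval (\<lambda>c. c) (entries A) f \<noteq> 0}))"

definition unipotent :: "'k::field^'n^'n \<Rightarrow> bool" where
  "unipotent A \<longleftrightarrow> (\<exists>k. (((**) (A - mat 1)) ^^ k) (mat 1) = 0)"

text \<open>An affine algebraic group over a field \<open>k\<close> of characteristic 0 is smooth, and is a closed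
  subgroup of some \<open>GL\<^sub>n\<close>; so it is given by equations \<open>S\<close> over \<open>k\<close> whose solutions over an
  algebraic closure of \<open>k\<close> form a group. It is reductive if its unipotent radical (the largest
  connected normal unipotent closed subgroup, over the algebraic closure) is trivial. The group
  itself is not required to be connected.\<close>

definition reductive_group :: "('n::finite \<times> 'n, 'f::field) mvpoly set \<Rightarrow> bool" where
  "reductive_group S \<longleftrightarrow>
     (let G = group_points to_ac S :: ('f alg_closure^'n^'n) set in
        matrix_group G \<and>
        (\<forall>U. U \<subseteq> G \<and> matrix_group U \<and> closedin (subtopology zariski G) U \<and>
             connectedin zariski U \<and> (\<forall>A\<in>G. \<forall>B\<in>U. A ** B ** matrix_inv A \<in> U) \<and>
             (\<forall>A\<in>U. unipotent A) \<longrightarrow> U = {mat 1}))"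

abbreviation rational_points :: "('n::finite \<times> 'n, 'f::field) mvpoly set \<Rightarrow> ('f^'n^'n) set" where
  "rational_points S \<equiv> group_points (\<lambda>c. c) S"


section \<open>Smooth admissible representations\<close>

definition matrix_topology :: "('f::field \<Rightarrow> real) \<Rightarrow> ('f^'n::finite^'n) topology" where
  "matrix_topology a =
     Metric_space.mtopology UNIV (\<lambda>A B. Max {a (A $ i $ j - B $ i $ j) | i j. True})"

definition is_representation ::
  "('f::field^'n^'n) set \<Rightarrow> ('e::field \<Rightarrow> 'v::ab_group_add \<Rightarrow> 'v) \<Rightarrow> ('f^'n^'n \<Rightarrow> 'v \<Rightarrow> 'v) \<Rightarrow> bool" where
  "is_representation G scl act \<longleftrightarrow>
     (\<forall>g\<in>G. Vector_Spaces.linear scl scl (act g)) \<and>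
     (\<forall>v. act (mat 1) v = v) \<and>
     (\<forall>g\<in>G. \<forall>h\<in>G. \<forall>v. act (g ** h) v = act g (act h v))"

definition smooth_representation ::
  "('f::field^'n::finite^'n) topology \<Rightarrow> ('f^'n^'n \<Rightarrow> 'v::ab_group_add \<Rightarrow> 'v) \<Rightarrow> bool" where
  "smooth_representation T act \<longleftrightarrow> (\<forall>v. openin T {g \<in> topspace T. act g v = v})"

definition admissible_representation ::
  "('f::field^'n::finite^'n) topology \<Rightarrow> ('e::field \<Rightarrow> 'v::ab_group_add \<Rightarrow> 'v) \<Rightarrow>
   ('f^'n^'n \<Rightarrow> 'v \<Rightarrow> 'v) \<Rightarrow> bool" where
  "admissible_representation T scl act \<longleftrightarrow>
     (\<forall>K. matrix_group K \<and> openin T K \<and> compactin T K \<longrightarrow>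
        (\<exists>B. finite B \<and> {v. \<forall>k\<in>K. act k v = v} \<subseteq> module.span scl B))"


section \<open>Algebraic representations of the restriction of scalars\<close>

text \<open>Let \<open>hF\<close>, \<open>hE\<close> be the embeddings of \<open>\<rat>\<^sub>p\<close> into \<open>F\<close>, \<open>E\<close>, let \<open>\<Omega>\<close> be the algebraic closure of
  \<open>E\<close> and let \<open>B\<close> be a \<open>\<rat>\<^sub>p\<close>-basis of \<open>F\<close>. A matrix \<open>\<Sum>\<^sub>b b \<otimes> Y\<^sub>b\<close> over \<open>F \<otimes> \<Omega>\<close> (tensor
  product over \<open>\<rat>\<^sub>p\<close>) is represented by its family of coordinates \<open>Y\<close>. The isomorphism of \<open>F \<otimes> \<Omega>\<close>
  with the product of copies of \<open>\<Omega>\<close> indexed by the \<open>\<rat>\<^sub>p\<close>-embeddings \<open>t : F \<rightarrow> \<Omega>\<close> maps it to the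
  family of its components \<open>\<Sum>\<^sub>b t(b) Y\<^sub>b\<close>. Accordingly, \<open>Y\<close> is an \<open>\<Omega>\<close>-point of the restriction
  of scalars of the group defined by \<open>S\<close> iff each component is a point of the conjugate by \<open>t\<close>.\<close>

definition scalar_embeddings ::
  "('q::field \<Rightarrow> 'f::field) \<Rightarrow> ('q \<Rightarrow> 'e::field) \<Rightarrow> ('f \<Rightarrow> 'e alg_closure) set" where
  "scalar_embeddings hF hE = {t. field_hom t \<and> (\<forall>c. t (hF c) = to_ac (hE c))}"

definition res_component ::
  "'f set \<Rightarrow> ('f \<Rightarrow> 'k::field) \<Rightarrow> ('f \<Rightarrow> 'k^'n^'n) \<Rightarrow> 'k^'n^'n" where
  "res_component B t Y = (\<chi> i j. \<Sum>b\<in>B. t b * Y b $ i $ j)"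

definition res_points ::
  "('q::field \<Rightarrow> 'f::field) \<Rightarrow> ('q \<Rightarrow> 'e::field) \<Rightarrow> 'f set \<Rightarrow>
   ('n::finite \<times> 'n, 'f) mvpoly set \<Rightarrow> ('f \<Rightarrow> 'e alg_closure^'n^'n) set" where
  "res_points hF hE B S = {Y. (\<forall>b. b \<notin> B \<longrightarrow> Y b = 0) \<and>
     (\<forall>t\<in>scalar_embeddings hF hE. res_component B t Y \<in> group_points t S)}"

text \<open>The coordinates of the matrix over \<open>F \<otimes> \<Omega>\<close> with given components.\<close>

definition res_of_components ::
  "('q::field \<Rightarrow> 'f::field) \<Rightarrow> ('q \<Rightarrow> 'e::field) \<Rightarrow> 'f set \<Rightarrow>
   (('f \<Rightarrow> 'e alg_closure) \<Rightarrow> 'e alg_closure^'n^'n) \<Rightarrow> 'f \<Rightarrow> 'e alg_closure^'n^'n" where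
  "res_of_components hF hE B c = (THE Y. (\<forall>b. b \<notin> B \<longrightarrow> Y b = 0) \<and>
     (\<forall>t\<in>scalar_embeddings hF hE. res_component B t Y = c t))"

definition res_mult ::
  "('q::field \<Rightarrow> 'f::field) \<Rightarrow> ('q \<Rightarrow> 'e::field) \<Rightarrow> 'f set \<Rightarrow>
   ('f \<Rightarrow> 'e alg_closure^'n::finite^'n) \<Rightarrow> ('f \<Rightarrow> 'e alg_closure^'n^'n) \<Rightarrow> 'f \<Rightarrow> 'e alg_closure^'n^'n" where
  "res_mult hF hE B Z Y =
     res_of_components hF hE B (\<lambda>t. res_component B t Z ** res_component B t Y)"

definition res_inv ::
  "('q::field \<Rightarrow> 'f::field) \<Rightarrow> ('q \<Rightarrow> 'e::field) \<Rightarrow> 'f set \<Rightarrow>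
   ('f \<Rightarrow> 'e alg_closure^'n::finite^'n) \<Rightarrow> 'f \<Rightarrow> 'e alg_closure^'n^'n" where
  "res_inv hF hE B Y = res_of_components hF hE B (\<lambda>t. matrix_inv (res_component B t Y))"

text \<open>The coordinates, mapped to \<open>E\<close>, of a matrix over \<open>F\<close> viewed as a \<open>\<rat>\<^sub>p\<close>-point.\<close>

definition res_coords ::
  "('q::field \<Rightarrow> 'f::field) \<Rightarrow> ('q \<Rightarrow> 'e::field) \<Rightarrow> 'f set \<Rightarrow> 'f^'n^'n \<Rightarrow> 'f \<Rightarrow> 'e^'n^'n" where
  "res_coords hF hE B A =
     (\<lambda>b. \<chi> i j. hE (module.representation (ext_scale hF) B (A $ i $ j) b))"

text \<open>The regular functions defined over \<open>E\<close> on the restriction of scalars are the polynomials over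
  \<open>E\<close> in the coordinates of a point and of its inverse.\<close>

definition res_vars ::
  "('f \<Rightarrow> 'k^'n^'n) \<Rightarrow> ('f \<Rightarrow> 'k^'n^'n) \<Rightarrow> ('f \<times> 'n \<times> 'n) + ('f \<times> 'n \<times> 'n) \<Rightarrow> 'k" where
  "res_vars Y Y' = case_sum (\<lambda>(b, i, j). Y b $ i $ j) (\<lambda>(b, i, j). Y' b $ i $ j)"

text \<open>\<open>act\<close> is the restriction to \<open>G(F)\<close>, the \<open>\<rat>\<^sub>p\<close>-points of the restriction of scalars, of a
  homomorphism of algebraic groups over \<open>E\<close> from (the base change to \<open>E\<close> of) the restriction of
  scalars to the general linear group of a finite-dimensional space. In a basis \<open>C\<close> of this space,
  the homomorphism is given by matrix coefficients \<open>r\<close>; that it is a homomorphism is tested on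
  \<open>\<Omega>\<close>-points, and it preserves the unit because \<open>act\<close> does.\<close>

definition algebraic_representation ::
  "('q::field \<Rightarrow> 'f::field) \<Rightarrow> ('q \<Rightarrow> 'e::field) \<Rightarrow> ('n::finite \<times> 'n, 'f) mvpoly set \<Rightarrow>
   ('e \<Rightarrow> 's::ab_group_add \<Rightarrow> 's) \<Rightarrow> ('f^'n^'n \<Rightarrow> 's \<Rightarrow> 's) \<Rightarrow> bool" where
  "algebraic_representation hF hE S scl act \<longleftrightarrow>
     is_representation (rational_points S) scl act \<and>
     (\<exists>B C. \<exists>r :: 's \<Rightarrow> 's \<Rightarrow> (('f \<times> 'n \<times> 'n) + ('f \<times> 'n \<times> 'n), 'e) mvpoly.
        finite_basis (ext_scale hF) B \<and> finite_basis scl C \<and>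
        (let R = (\<lambda>Y c d. mv_eval to_ac (res_vars Y (res_inv hF hE B Y)) (r c d)) in
           \<forall>Z\<in>res_points hF hE B S. \<forall>Y\<in>res_points hF hE B S. \<forall>c\<in>C. \<forall>d\<in>C.
             R (res_mult hF hE B Z Y) c d = (\<Sum>e\<in>C. R Z c e * R Y e d)) \<and>
        (\<forall>g\<in>rational_points S. \<forall>d\<in>C. act g d =
           (\<Sum>c\<in>C. scl (mv_eval (\<lambda>a. a)
              (res_vars (res_coords hF hE B g) (res_coords hF hE B (matrix_inv g))) (r c d)) c)))"


section \<open>Tensor products\<close>

text \<open>The space of finitely supported functions on \<open>'p \<times> 's\<close>, with basis the pairs.\<close>

definition free_scale :: "'e::field \<Rightarrow> ('i \<Rightarrow>\<^sub>0 'e) \<Rightarrow> 'i \<Rightarrow>\<^sub>0 'e" where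
  "free_scale c x = Poly_Mapping.map ((*) c) x"

abbreviation free_pair :: "'p \<Rightarrow> 's \<Rightarrow> ('p \<times> 's) \<Rightarrow>\<^sub>0 'e::field" where
  "free_pair x y \<equiv> Poly_Mapping.single (x, y) 1"

definition tensor_relations ::
  "('e::field \<Rightarrow> 'p::ab_group_add \<Rightarrow> 'p) \<Rightarrow> ('e \<Rightarrow> 's::ab_group_add \<Rightarrow> 's) \<Rightarrow> (('p \<times> 's) \<Rightarrow>\<^sub>0 'e) set" where
  "tensor_relations scaleP scaleS =
     {free_pair (x + x') y - free_pair x y - free_pair x' y | x x' y. True} \<union>
     {free_pair x (y + y') - free_pair x y - free_pair x y' | x y y'. True} \<union>
     {free_pair (scaleP c x) y - free_scale c (free_pair x y) | c x y. True} \<union>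
     {free_pair x (scaleS c y) - free_scale c (free_pair x y) | c x y. True}"

definition tensor_lift ::
  "('e::field \<Rightarrow> 'v::ab_group_add \<Rightarrow> 'v) \<Rightarrow> ('p \<Rightarrow> 's \<Rightarrow> 'v) \<Rightarrow> (('p \<times> 's) \<Rightarrow>\<^sub>0 'e) \<Rightarrow> 'v" where
  "tensor_lift scaleV t z =
     (\<Sum>k\<in>Poly_Mapping.keys z. scaleV (Poly_Mapping.lookup z k) (t (fst k) (snd k)))"

text \<open>\<open>V\<close> with \<open>t x y = x \<otimes> y\<close> is the tensor product: \<open>t\<close> induces an isomorphism with \<open>V\<close> of the
  quotient of the free vector space on the pairs by the subspace spanned by the relations of
  bilinearity.\<close>

definition is_tensor_product ::
  "('e::field \<Rightarrow> 'p::ab_group_add \<Rightarrow> 'p) \<Rightarrow> ('e \<Rightarrow> 's::ab_group_add \<Rightarrow> 's) \<Rightarrow>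
   ('e \<Rightarrow> 'v::ab_group_add \<Rightarrow> 'v) \<Rightarrow> ('p \<Rightarrow> 's \<Rightarrow> 'v) \<Rightarrow> bool" where
  "is_tensor_product scaleP scaleS scaleV t \<longleftrightarrow>
     surj (tensor_lift scaleV t) \<and>
     {z. tensor_lift scaleV t z = 0} = module.span free_scale (tensor_relations scaleP scaleS)"

definition is_diagonal_action ::
  "('f::field^'n^'n) set \<Rightarrow> ('e::field \<Rightarrow> 'v::ab_group_add \<Rightarrow> 'v) \<Rightarrow> ('p \<Rightarrow> 's \<Rightarrow> 'v) \<Rightarrow>
   ('f^'n^'n \<Rightarrow> 'p \<Rightarrow> 'p) \<Rightarrow> ('f^'n^'n \<Rightarrow> 's \<Rightarrow> 's) \<Rightarrow> ('f^'n^'n \<Rightarrow> 'v \<Rightarrow> 'v) \<Rightarrow> bool" where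
  "is_diagonal_action G scaleV t actP actS act \<longleftrightarrow>
     (\<forall>g\<in>G. Vector_Spaces.linear scaleV scaleV (act g) \<and>
        (\<forall>x y. act g (t x y) = t (actP g x) (actS g y)))"


section \<open>Norms\<close>

definition is_norm ::
  "('e::field \<Rightarrow> real) \<Rightarrow> ('e \<Rightarrow> 'v::ab_group_add \<Rightarrow> 'v) \<Rightarrow> ('v \<Rightarrow> real) \<Rightarrow> bool" where
  "is_norm absE scl \<alpha> \<longleftrightarrow> (\<forall>v. 0 \<le> \<alpha> v) \<and> (\<forall>c v. \<alpha> (scl c v) = absE c * \<alpha> v) \<and>
     (\<forall>v w. \<alpha> (v + w) \<le> max (\<alpha> v) (\<alpha> w)) \<and> (\<forall>v. \<alpha> v = 0 \<longrightarrow> v = 0)"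

text \<open>The supremum is taken in \<open>[0, \<infinity>]\<close>; in particular it is \<open>0\<close> if the space is \<open>0\<close>.\<close>

definition d_inf :: "('v::zero \<Rightarrow> real) \<Rightarrow> ('v \<Rightarrow> real) \<Rightarrow> ennreal" where
  "d_inf \<alpha> \<beta> = (SUP v\<in>{v. v \<noteq> 0}. ennreal \<bar>ln (\<alpha> v / \<beta> v)\<bar>)"

definition norm_component ::
  "('e::field \<Rightarrow> real) \<Rightarrow> ('e \<Rightarrow> 'v::ab_group_add \<Rightarrow> 'v) \<Rightarrow> ('v \<Rightarrow> real) \<Rightarrow> ('v \<Rightarrow> real) set" where
  "norm_component absE scl \<alpha>\<^sub>0 = {\<alpha>. is_norm absE scl \<alpha> \<and> d_inf \<alpha> \<alpha>\<^sub>0 < \<infinity>}"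

definition norm_act ::
  "('f::field^'n^'n \<Rightarrow> 'v \<Rightarrow> 'v) \<Rightarrow> 'f^'n^'n \<Rightarrow> ('v \<Rightarrow> real) \<Rightarrow> 'v \<Rightarrow> real" where
  "norm_act act g \<alpha> v = \<alpha> (act (matrix_inv g) v)"

definition invariant_norm ::
  "('f::field^'n^'n) set \<Rightarrow> ('f^'n^'n \<Rightarrow> 'v \<Rightarrow> 'v) \<Rightarrow> ('v \<Rightarrow> real) \<Rightarrow> bool" where
  "invariant_norm G act \<alpha> \<longleftrightarrow> (\<forall>g\<in>G. norm_act act g \<alpha> = \<alpha>)"

end

theory Submission
  imports Defs
begin

text \<open>The distance \<open>d_inf\<close> is the supremum metric on the functions \<open>ln \<circ> \<alpha>\<close>, and \<open>G\<close> acts on norms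
  by isometries. An invariant norm \<open>\<beta>\<close> is at the same distance \<open>r\<close> from every point of the
  orbit of \<open>\<alpha>\<^sub>0\<close>, so the triangle inequality gives \<open>D \<le> 2 r\<close>: no invariant norm is closer to
  \<open>\<alpha>\<^sub>0\<close> than \<open>D / 2\<close> (lemma \<open>orbit_diameter_le_twice_dist_invariant\<close>).

  Conversely, boundedness says that every translate of \<open>\<alpha>\<^sub>0\<close> is at most \<open>exp D \<cdot> \<alpha>\<^sub>0\<close>, while \<open>\<alpha>\<^sub>0\<close> is
  itself one of the translates. Hence the supremum \<open>\<alpha>\<^sub>G\<close> of the orbit exists and lies between \<open>\<alpha>\<^sub>0\<close>
  and \<open>exp D \<cdot> \<alpha>\<^sub>0\<close>; on the logarithmic scale this is an interval of length \<open>D\<close>, and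
  multiplication by \<open>exp (- D / 2)\<close> moves the centre of the interval to \<open>\<alpha>\<^sub>0\<close>. So the rescaled norm
  attains the lower bound (lemmas \<open>sup_norm_between\<close> and \<open>dist_scaled_sup_norm_le\<close>).

  Both halves use that a group acts linearly on the whole space: \<open>G\<close> inherits the group laws from
  the points over the algebraic closure (lemma \<open>matrix_group_rational_points\<close>), and the
  diagonal action, prescribed only on pure tensors, is a representation because these span (lemma
  \<open>is_representation_diagonal\<close>).\<close>

section \<open>Rational points of an algebraic group\<close>

lemma matrix_inv_eqI:
  fixes A B :: "'a::semiring_1^'n^'n"
  assumes "A ** B = mat 1" "B ** A = mat 1"
  shows "matrix_inv A = B"
proof -
  have ex: "\<exists>A'. A ** A' = mat 1 \<and> A' ** A = mat 1" using assms by blast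
  have *: "A ** matrix_inv A = mat 1 \<and> matrix_inv A ** A = mat 1"
    unfolding matrix_inv_def by (rule someI_ex[OF ex])
  have "matrix_inv A = matrix_inv A ** (A ** B)" using assms by (simp add: matrix_mul_rid)
  also have "\<dots> = B" using * by (simp add: matrix_mul_assoc matrix_mul_lid)
  finally show ?thesis .
qed

lemma
  fixes A :: "'a::semiring_1^'n^'n"
  assumes "invertible A"
  shows matrix_mul_inv: "A ** matrix_inv A = mat 1"
    and matrix_inv_mul: "matrix_inv A ** A = mat 1"
proof -
  obtain B where "A ** B = mat 1" "B ** A = mat 1"
    using assms unfolding invertible_def by blast
  then show "A ** matrix_inv A = mat 1" "matrix_inv A ** A = mat 1"
    using matrix_inv_eqI[of A B] by simp_all
qed

lemma matrix_inv_inv: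
  fixes A :: "'a::semiring_1^'n^'n"
  shows "invertible A \<Longrightarrow> matrix_inv (matrix_inv A) = A"
  by (intro matrix_inv_eqI matrix_mul_inv matrix_inv_mul)

lemma matrix_inv_mult:
  fixes A B :: "'a::semiring_1^'n^'n"
  assumes "invertible A" "invertible B"
  shows "matrix_inv (A ** B) = matrix_inv B ** matrix_inv A"
proof (rule matrix_inv_eqI)
  have "A ** B ** (matrix_inv B ** matrix_inv A) = A ** (B ** matrix_inv B) ** matrix_inv A"
    by (simp only: matrix_mul_assoc)
  then show "A ** B ** (matrix_inv B ** matrix_inv A) = mat 1"
    using assms by (simp add: matrix_mul_inv matrix_mul_rid)
  have "matrix_inv B ** matrix_inv A ** (A ** B) = matrix_inv B ** (matrix_inv A ** A) ** B"
    by (simp only: matrix_mul_assoc)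
  then show "matrix_inv B ** matrix_inv A ** (A ** B) = mat 1"
    using assms by (simp add: matrix_inv_mul matrix_mul_rid)
qed

lemma map_matrix_to_ac_mult:
  "map_matrix to_ac (A ** B) = map_matrix to_ac A ** map_matrix to_ac B"
  by (simp add: vec_eq_iff matrix_matrix_mult_def to_ac_sum)

lemma map_matrix_to_ac_one: "map_matrix to_ac (mat 1) = mat 1"
  by (simp add: vec_eq_iff mat_def)

lemma mv_eval_map_matrix_to_ac:
  "mv_eval to_ac (entries (map_matrix to_ac A)) f = to_ac (mv_eval (\<lambda>c. c) (entries A) f)"
  by (simp add: mv_eval_def to_ac_sum to_ac_prod entries_def case_prod_beta)

lemma rational_points_iff:
  fixes A :: "'f::field^'n::finite^'n"
  assumes "invertible A"
  shows "A \<in> rational_points S \<longleftrightarrow> map_matrix to_ac A \<in> group_points to_ac S"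
proof -
  obtain B where "A ** B = mat 1" "B ** A = mat 1"
    using assms unfolding invertible_def by blast
  then have "map_matrix to_ac A ** map_matrix to_ac B = mat 1"
      "map_matrix to_ac B ** map_matrix to_ac A = mat 1"
    by (simp_all only: map_matrix_to_ac_one map_matrix_to_ac_mult[symmetric])
  then have "invertible (map_matrix to_ac A)"
    unfolding invertible_def by (intro exI conjI)
  with assms show ?thesis
    by (simp add: group_points_def mv_eval_map_matrix_to_ac)
qed

text \<open>Only the points over the algebraic closure are known to form a group; since \<open>to_ac\<close> is
  injective, a matrix over the base field satisfies the equations iff its image does, and the group
  laws descend.\<close>

lemma matrix_group_rational_points:
  fixes S :: "('n::finite \<times> 'n, 'f::field) mvpoly set"
  assumes "matrix_group (group_points to_ac S)"
  shows "matrix_group (rational_points S)"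
proof -
  let ?H = "group_points to_ac S" and ?h = "map_matrix to_ac"
  have H: "mat 1 \<in> ?H" "\<And>A B. A \<in> ?H \<Longrightarrow> B \<in> ?H \<Longrightarrow> A ** B \<in> ?H"
      "\<And>A. A \<in> ?H \<Longrightarrow> matrix_inv A \<in> ?H"
    using assms by (simp_all add: matrix_group_def)
  have inv: "invertible A" if "A \<in> rational_points S" for A
    using that by (simp add: group_points_def)
  have up: "?h A \<in> ?H" if "A \<in> rational_points S" for A
    using that rational_points_iff[OF inv[OF that]] by blast
  have "invertible (mat 1 :: 'f^'n^'n)"
    unfolding invertible_def by (intro exI[of _ "mat 1"]) (simp add: matrix_mul_lid)
  then have one: "mat 1 \<in> rational_points S"
    using H(1) by (simp add: rational_points_iff map_matrix_to_ac_one)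
  have mult: "A ** B \<in> rational_points S"
    if "A \<in> rational_points S" "B \<in> rational_points S" for A B
    using H(2)[OF up[OF that(1)] up[OF that(2)]] invertible_mult[OF inv[OF that(1)] inv[OF that(2)]]
    by (simp add: rational_points_iff map_matrix_to_ac_mult)
  have "matrix_inv A \<in> rational_points S" if A: "A \<in> rational_points S" for A
  proof -
    have 1: "A ** matrix_inv A = mat 1" "matrix_inv A ** A = mat 1"
      using inv[OF A] by (simp_all add: matrix_mul_inv matrix_inv_mul)
    then have "?h A ** ?h (matrix_inv A) = mat 1" "?h (matrix_inv A) ** ?h A = mat 1"
      by (simp_all only: map_matrix_to_ac_one map_matrix_to_ac_mult[symmetric])
    then have "?h (matrix_inv A) = matrix_inv (?h A)"
      by (rule matrix_inv_eqI[symmetric])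
    moreover have "invertible (matrix_inv A)"
      using 1 unfolding invertible_def by blast
    ultimately show ?thesis
      using H(3)[OF up[OF A]] by (simp add: rational_points_iff)
  qed
  with inv one mult show ?thesis by (simp add: matrix_group_def)
qed


section \<open>The diagonal action on a tensor product\<close>

lemma linear_eq_on_pure_tensors:
  assumes lin: "Vector_Spaces.linear scaleV scaleV f" "Vector_Spaces.linear scaleV scaleV g"
    and surj: "surj (tensor_lift scaleV t)"
    and eq: "\<And>x y. f (t x y) = g (t x y)"
  shows "f v = g v"
proof -
  interpret f: Vector_Spaces.linear scaleV scaleV f by (rule lin)
  interpret g: Vector_Spaces.linear scaleV scaleV g by (rule lin)
  obtain z where "v = tensor_lift scaleV t z" using surj by (metis surjD)
  then show ?thesis
    by (simp add: tensor_lift_def f.sum g.sum f.scale g.scale eq)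
qed

lemma is_representation_diagonal:
  assumes P: "is_representation G scaleP actP" and S: "is_representation G scaleS actS"
    and V: "vector_space scaleV" "is_tensor_product scaleP scaleS scaleV t"
      "is_diagonal_action G scaleV t actP actS act"
    and G: "matrix_group G"
  shows "is_representation G scaleV act"
proof -
  interpret V: vector_space scaleV by (rule V)
  have lin: "Vector_Spaces.linear scaleV scaleV (act g)" if "g \<in> G" for g
    using V(3) that by (simp add: is_diagonal_action_def)
  have tens: "act g (t x y) = t (actP g x) (actS g y)" if "g \<in> G" for g x y
    using V(3) that by (simp add: is_diagonal_action_def)
  have surj: "surj (tensor_lift scaleV t)" using V(2) by (simp add: is_tensor_product_def)
  have one: "mat 1 \<in> G" and mult: "\<And>g h. g \<in> G \<Longrightarrow> h \<in> G \<Longrightarrow> g ** h \<in> G"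
    using G by (simp_all add: matrix_group_def)
  have "act (mat 1) v = id v" for v
    by (rule linear_eq_on_pure_tensors[OF lin[OF one] V.linear_id surj])
      (use P S in \<open>simp add: tens[OF one] is_representation_def\<close>)
  moreover have "act (g ** h) v = (act g \<circ> act h) v" if "g \<in> G" "h \<in> G" for g h v
  proof (rule linear_eq_on_pure_tensors[OF lin[OF mult[OF that]] _ surj])
    show "Vector_Spaces.linear scaleV scaleV (act g \<circ> act h)"
      by (rule Vector_Spaces.linear_compose[OF lin[OF that(2)] lin[OF that(1)]])
    show "act (g ** h) (t x y) = (act g \<circ> act h) (t x y)" for x y
      using P S that mult by (simp add: tens is_representation_def)
  qed
  ultimately show ?thesis using lin by (simp add: is_representation_def)
qed


section \<open>The supremum metric\<close>

lemma d_inf_commute: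
  assumes "\<And>v. v \<noteq> 0 \<Longrightarrow> 0 < \<alpha> v" "\<And>v. v \<noteq> 0 \<Longrightarrow> 0 < \<beta> v"
  shows "d_inf \<alpha> \<beta> = d_inf \<beta> \<alpha>"
  unfolding d_inf_def using assms by (intro SUP_cong) (auto simp: ln_div abs_minus_commute)

lemma d_inf_triangle:
  assumes pos: "\<And>v. v \<noteq> 0 \<Longrightarrow> 0 < \<alpha> v" "\<And>v. v \<noteq> 0 \<Longrightarrow> 0 < \<beta> v" "\<And>v. v \<noteq> 0 \<Longrightarrow> 0 < \<gamma> v"
  shows "d_inf \<alpha> \<gamma> \<le> d_inf \<alpha> \<beta> + d_inf \<beta> \<gamma>"
  unfolding d_inf_def[of \<alpha> \<gamma>]
proof (rule SUP_least)
  fix v :: 'a assume v: "v \<in> {v. v \<noteq> 0}"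
  have "\<bar>ln (\<alpha> v / \<gamma> v)\<bar> \<le> \<bar>ln (\<alpha> v / \<beta> v)\<bar> + \<bar>ln (\<beta> v / \<gamma> v)\<bar>"
    using pos[of v] v by (simp add: ln_div)
  then have "ennreal \<bar>ln (\<alpha> v / \<gamma> v)\<bar> \<le> ennreal \<bar>ln (\<alpha> v / \<beta> v)\<bar> + ennreal \<bar>ln (\<beta> v / \<gamma> v)\<bar>"
    by (simp flip: ennreal_plus)
  also have "\<dots> \<le> d_inf \<alpha> \<beta> + d_inf \<beta> \<gamma>"
    unfolding d_inf_def using v by (intro add_mono SUP_upper)
  finally show "ennreal \<bar>ln (\<alpha> v / \<gamma> v)\<bar> \<le> d_inf \<alpha> \<beta> + d_inf \<beta> \<gamma>" .
qed

lemma d_inf_le_iff: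
  assumes pos: "\<And>v. v \<noteq> 0 \<Longrightarrow> 0 < \<alpha> v" "\<And>v. v \<noteq> 0 \<Longrightarrow> 0 < \<beta> v" and c: "0 \<le> c"
  shows "d_inf \<alpha> \<beta> \<le> ennreal c \<longleftrightarrow>
    (\<forall>v. v \<noteq> 0 \<longrightarrow> \<alpha> v \<le> exp c * \<beta> v \<and> \<beta> v \<le> exp c * \<alpha> v)"
proof -
  have "\<bar>ln (a / b)\<bar> \<le> c \<longleftrightarrow> a \<le> exp c * b \<and> b \<le> exp c * a" if "0 < a" "0 < b" for a b :: real
  proof -
    have *: "x \<le> exp c * y \<longleftrightarrow> ln x \<le> c + ln y" if "0 < x" "0 < y" for x y :: real
      using that ln_le_cancel_iff[of x "exp c * y"] by (simp add: ln_mult)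
    show ?thesis using that by (auto simp: * ln_div abs_le_iff)
  qed
  then show ?thesis
    using pos c by (auto simp: d_inf_def SUP_le_iff ennreal_le_iff)
qed


section \<open>Norms with bounded orbit\<close>

lemma nonarch_abs_zero: "nonarch_abs absE \<Longrightarrow> absE 0 = 0"
  by (simp add: nonarch_abs_def)

lemma is_norm_zero:
  assumes "is_norm absE scl \<alpha>" "nonarch_abs absE" "vector_space scl"
  shows "\<alpha> 0 = 0"
proof -
  interpret vector_space scl by (rule assms)
  have "\<alpha> (scl 0 0) = absE 0 * \<alpha> 0" using assms(1) unfolding is_norm_def by blast
  then show ?thesis using assms(2) by (simp add: nonarch_abs_zero)
qed

lemma is_norm_pos: "is_norm absE scl \<alpha> \<Longrightarrow> v \<noteq> 0 \<Longrightarrow> 0 < \<alpha> v"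
  unfolding is_norm_def by (metis less_eq_real_def)

lemma is_norm_scaled:
  assumes "is_norm absE scl \<alpha>" "0 < c"
  shows "is_norm absE scl (\<lambda>v. c * \<alpha> v)"
proof -
  have "c * \<alpha> (v + w) \<le> max (c * \<alpha> v) (c * \<alpha> w)" for v w
  proof -
    have "c * \<alpha> (v + w) \<le> c * max (\<alpha> v) (\<alpha> w)"
      using assms by (intro mult_left_mono) (auto simp: is_norm_def)
    then show ?thesis using \<open>0 < c\<close> by (simp add: max_mult_distrib_left)
  qed
  then show ?thesis using assms by (simp add: is_norm_def)
qed

lemma invariant_norm_scaled: "invariant_norm G act \<alpha> \<Longrightarrow> invariant_norm G act (\<lambda>v. c * \<alpha> v)"
  unfolding invariant_norm_def norm_act_def fun_eq_iff by simp

locale norm_with_bounded_orbit =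
  fixes absE :: "'e::field \<Rightarrow> real" and scl :: "'e \<Rightarrow> 'v::ab_group_add \<Rightarrow> 'v"
    and G :: "('f::field^'n::finite^'n) set" and act :: "'f^'n^'n \<Rightarrow> 'v \<Rightarrow> 'v" and \<alpha> :: "'v \<Rightarrow> real"
  assumes absE: "nonarch_abs absE"
    and scl: "vector_space scl"
    and group: "matrix_group G"
    and rep: "is_representation G scl act"
    and norm: "is_norm absE scl \<alpha>"
    and bounded: "(SUP g\<in>G. d_inf \<alpha> (norm_act act g \<alpha>)) < \<infinity>"
begin

definition D :: real where "D = enn2real (SUP g\<in>G. d_inf \<alpha> (norm_act act g \<alpha>))"

definition sup_norm :: "'v \<Rightarrow> real" where
  "sup_norm v = (SUP g\<in>G. \<alpha> (act (matrix_inv g) v))"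

lemma D_nonneg: "0 \<le> D"
  by (simp add: D_def)

lemma ennreal_D: "ennreal D = (SUP g\<in>G. d_inf \<alpha> (norm_act act g \<alpha>))"
  using bounded by (simp add: D_def)

lemma translate_dist_le: "g \<in> G \<Longrightarrow> d_inf \<alpha> (norm_act act g \<alpha>) \<le> ennreal D"
  unfolding ennreal_D by (rule SUP_upper)

lemma one_mem: "mat 1 \<in> G"
  and mult_mem: "g \<in> G \<Longrightarrow> h \<in> G \<Longrightarrow> g ** h \<in> G"
  and inv_mem: "g \<in> G \<Longrightarrow> matrix_inv g \<in> G"
  and invertible_mem: "g \<in> G \<Longrightarrow> invertible g"
  using group by (simp_all add: matrix_group_def)

lemma act_one: "act (mat 1) v = v"
  using rep by (simp add: is_representation_def)

lemma act_mult: "g \<in> G \<Longrightarrow> h \<in> G \<Longrightarrow> act (g ** h) v = act g (act h v)"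
  using rep by (simp add: is_representation_def)

lemma act_act_inv: "g \<in> G \<Longrightarrow> act g (act (matrix_inv g) v) = v"
  and act_inv_act: "g \<in> G \<Longrightarrow> act (matrix_inv g) (act g v) = v"
  by (simp_all add: act_one inv_mem invertible_mem matrix_mul_inv matrix_inv_mul flip: act_mult)

lemma
  assumes "g \<in> G"
  shows act_add: "act g (v + w) = act g v + act g w"
    and act_scale: "act g (scl c v) = scl c (act g v)"
    and act_zero: "act g 0 = 0"
proof -
  interpret Vector_Spaces.linear scl scl "act g"
    using rep assms by (simp add: is_representation_def)
  show "act g (v + w) = act g v + act g w" "act g (scl c v) = scl c (act g v)" "act g 0 = 0"
    by (simp_all add: add scale)
qed

lemma act_eq_zero_iff: "g \<in> G \<Longrightarrow> act g v = 0 \<longleftrightarrow> v = 0"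
  by (metis act_inv_act act_zero inv_mem)

lemma norm_act_one: "norm_act act (mat 1) \<beta> = \<beta>"
  by (simp add: norm_act_def fun_eq_iff act_one matrix_inv_eqI matrix_mul_lid)

lemma norm_act_mult:
  "g \<in> G \<Longrightarrow> h \<in> G \<Longrightarrow> norm_act act (g ** h) \<beta> = norm_act act g (norm_act act h \<beta>)"
  by (simp add: norm_act_def fun_eq_iff matrix_inv_mult invertible_mem act_mult inv_mem)

lemma norm_act_pos:
  "(\<And>v. v \<noteq> 0 \<Longrightarrow> 0 < \<beta> v) \<Longrightarrow> g \<in> G \<Longrightarrow> v \<noteq> 0 \<Longrightarrow> 0 < norm_act act g \<beta> v"
  by (simp add: norm_act_def act_eq_zero_iff inv_mem)

lemma d_inf_norm_act:
  assumes g: "g \<in> G"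
  shows "d_inf (norm_act act g \<beta>) (norm_act act g \<gamma>) = d_inf \<beta> \<gamma>"
proof -
  have "v \<in> act (matrix_inv g) ` {v. v \<noteq> 0}" if "v \<noteq> 0" for v
    using that g by (intro image_eqI[of _ _ "act g v"]) (simp_all add: act_inv_act act_eq_zero_iff)
  then have im: "act (matrix_inv g) ` {v. v \<noteq> 0} = {v. v \<noteq> 0}"
    using g by (auto simp: act_eq_zero_iff inv_mem)
  have "d_inf \<beta> \<gamma> = (SUP v\<in>act (matrix_inv g) ` {v. v \<noteq> 0}. ennreal \<bar>ln (\<beta> v / \<gamma> v)\<bar>)"
    by (simp only: im d_inf_def)
  then show ?thesis by (simp add: d_inf_def norm_act_def image_comp comp_def)
qed

text \<open>By isometry, every distance within the orbit is a distance from its base point.\<close>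

lemma orbit_diameter:
  "(SUP g\<in>G. SUP h\<in>G. d_inf (norm_act act g \<alpha>) (norm_act act h \<alpha>)) = ennreal D"
proof (rule antisym)
  have "d_inf (norm_act act g \<alpha>) (norm_act act h \<alpha>) \<le> ennreal D" if "g \<in> G" "h \<in> G" for g h
  proof -
    let ?k = "matrix_inv g ** h"
    have k: "?k \<in> G" using that by (simp add: mult_mem inv_mem)
    have "g ** ?k = h"
      using that by (simp add: matrix_mul_assoc matrix_mul_inv invertible_mem matrix_mul_lid)
    then have "norm_act act h \<alpha> = norm_act act g (norm_act act ?k \<alpha>)"
      using norm_act_mult[OF that(1) k] by simp
    then show ?thesis
      using that k by (simp add: d_inf_norm_act translate_dist_le)
  qed
  then show "(SUP g\<in>G. SUP h\<in>G. d_inf (norm_act act g \<alpha>) (norm_act act h \<alpha>)) \<le> ennreal D"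
    by (intro SUP_least)
  show "ennreal D \<le> (SUP g\<in>G. SUP h\<in>G. d_inf (norm_act act g \<alpha>) (norm_act act h \<alpha>))"
    unfolding ennreal_D by (rule SUP_upper2[OF one_mem]) (simp add: norm_act_one)
qed

lemma orbit_diameter_le_twice_dist_invariant:
  assumes pos: "\<And>v. v \<noteq> 0 \<Longrightarrow> 0 < \<beta> v" and inv: "invariant_norm G act \<beta>"
  shows "ennreal D \<le> d_inf \<alpha> \<beta> + d_inf \<alpha> \<beta>"
  unfolding ennreal_D
proof (rule SUP_least)
  fix g assume g: "g \<in> G"
  have pos\<alpha>: "\<And>v. v \<noteq> 0 \<Longrightarrow> 0 < \<alpha> v" using norm by (rule is_norm_pos)
  have "d_inf \<beta> (norm_act act g \<alpha>) = d_inf (norm_act act g \<beta>) (norm_act act g \<alpha>)"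
    using inv g by (simp add: invariant_norm_def)
  also have "\<dots> = d_inf \<alpha> \<beta>"
    using g pos pos\<alpha> by (simp add: d_inf_norm_act d_inf_commute)
  finally have "d_inf \<beta> (norm_act act g \<alpha>) = d_inf \<alpha> \<beta>" .
  moreover have "d_inf \<alpha> (norm_act act g \<alpha>) \<le> d_inf \<alpha> \<beta> + d_inf \<beta> (norm_act act g \<alpha>)"
    using g pos pos\<alpha> by (intro d_inf_triangle norm_act_pos)
  ultimately show "d_inf \<alpha> (norm_act act g \<alpha>) \<le> d_inf \<alpha> \<beta> + d_inf \<alpha> \<beta>" by simp
qed

lemma translate_le:
  assumes "g \<in> G"
  shows "\<alpha> (act (matrix_inv g) v) \<le> exp D * \<alpha> v"
proof (cases "v = 0")
  case True
  then show ?thesis using assms norm absE scl by (simp add: act_zero inv_mem is_norm_zero)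
next
  case False
  have "d_inf \<alpha> (norm_act act g \<alpha>) \<le> ennreal D"
    using assms by (rule translate_dist_le)
  then have "norm_act act g \<alpha> v \<le> exp D * \<alpha> v"
    using False assms norm D_nonneg
    by (subst (asm) d_inf_le_iff) (auto intro: is_norm_pos norm_act_pos)
  then show ?thesis by (simp add: norm_act_def)
qed

lemma translate_le_sup_norm: "g \<in> G \<Longrightarrow> \<alpha> (act (matrix_inv g) v) \<le> sup_norm v"
  unfolding sup_norm_def using translate_le by (intro cSUP_upper bdd_aboveI2) auto

lemma sup_norm_le: "(\<And>g. g \<in> G \<Longrightarrow> \<alpha> (act (matrix_inv g) v) \<le> c) \<Longrightarrow> sup_norm v \<le> c"
  unfolding sup_norm_def using one_mem by (intro cSUP_least) auto

lemma sup_norm_between: "\<alpha> v \<le> sup_norm v" "sup_norm v \<le> exp D * \<alpha> v"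
  using translate_le_sup_norm[OF one_mem, of v] norm_act_one[of \<alpha>]
  by (auto simp: norm_act_def fun_eq_iff intro: sup_norm_le translate_le)

lemma sup_norm_scale_le: "sup_norm (scl c v) \<le> absE c * sup_norm v"
proof (rule sup_norm_le)
  fix g assume g: "g \<in> G"
  have "\<alpha> (act (matrix_inv g) (scl c v)) = absE c * \<alpha> (act (matrix_inv g) v)"
    using g norm by (simp add: act_scale inv_mem is_norm_def)
  also have "\<dots> \<le> absE c * sup_norm v"
    using g absE by (intro mult_left_mono translate_le_sup_norm) (auto simp: nonarch_abs_def)
  finally show "\<alpha> (act (matrix_inv g) (scl c v)) \<le> absE c * sup_norm v" .
qed

lemma sup_norm_scale: "sup_norm (scl c v) = absE c * sup_norm v"
proof (rule antisym[OF sup_norm_scale_le])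
  interpret vector_space scl by (rule scl)
  have nonneg: "0 \<le> sup_norm v" for v
    using sup_norm_between(1) norm by (metis is_norm_def order_trans)
  show "absE c * sup_norm v \<le> sup_norm (scl c v)"
  proof (cases "c = 0")
    case True
    then show ?thesis using absE nonneg by (simp add: nonarch_abs_zero)
  next
    case False
    \<comment> \<open>The reverse inequality is the forward one for the inverse scalar.\<close>
    have mult: "absE (x * y) = absE x * absE y" for x y
      using absE by (simp add: nonarch_abs_def)
    have "absE 1 \<noteq> 0" using absE by (simp add: nonarch_abs_def)
    then have "absE 1 = 1" using mult[of 1 1] by simp
    then have inverse: "absE c * absE (inverse c) = 1"
      using False by (simp flip: mult)
    have "absE c * sup_norm v \<le> absE c * (absE (inverse c) * sup_norm (scl c v))"
      using sup_norm_scale_le[of "inverse c" "scl c v"] False absE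
      by (intro mult_left_mono) (auto simp: nonarch_abs_def)
    also have "\<dots> = sup_norm (scl c v)"
      by (simp only: inverse mult_1 flip: mult.assoc)
    finally show ?thesis .
  qed
qed

lemma is_norm_sup_norm: "is_norm absE scl sup_norm"
proof -
  have "sup_norm (v + w) \<le> max (sup_norm v) (sup_norm w)" for v w
  proof (rule sup_norm_le)
    fix g assume g: "g \<in> G"
    have "\<alpha> (act (matrix_inv g) (v + w))
        \<le> max (\<alpha> (act (matrix_inv g) v)) (\<alpha> (act (matrix_inv g) w))"
      using g norm by (simp add: act_add inv_mem is_norm_def)
    also have "\<dots> \<le> max (sup_norm v) (sup_norm w)"
      using g by (intro max.mono translate_le_sup_norm)
    finally show "\<alpha> (act (matrix_inv g) (v + w)) \<le> max (sup_norm v) (sup_norm w)" .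
  qed
  moreover have "0 \<le> sup_norm v" "sup_norm v = 0 \<longrightarrow> v = 0" for v
    using sup_norm_between(1)[of v] norm unfolding is_norm_def
    by (metis order_trans, metis order_antisym)
  ultimately show ?thesis by (simp add: is_norm_def sup_norm_scale)
qed

text \<open>Translating the argument by \<open>g\<close> only permutes the translates over which the supremum is
  taken.\<close>

lemma invariant_norm_sup_norm: "invariant_norm G act sup_norm"
proof -
  have le: "sup_norm (act g v) \<le> sup_norm v" if g: "g \<in> G" for g v
  proof (rule sup_norm_le)
    fix h assume h: "h \<in> G"
    let ?k = "matrix_inv g ** h"
    have k: "?k \<in> G" using g h by (simp add: mult_mem inv_mem)
    have "matrix_inv ?k = matrix_inv h ** g"
      using g h by (simp add: matrix_inv_mult matrix_inv_inv invertible_mem inv_mem)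
    then have "act (matrix_inv h) (act g v) = act (matrix_inv ?k) v"
      using g h by (simp add: act_mult inv_mem)
    then show "\<alpha> (act (matrix_inv h) (act g v)) \<le> sup_norm v"
      using translate_le_sup_norm[OF k] by simp
  qed
  have "sup_norm (act (matrix_inv g) v) = sup_norm v" if "g \<in> G" for g v
    using le[of g "act (matrix_inv g) v"] le[of "matrix_inv g" v] that
    by (simp add: inv_mem act_act_inv)
  then show ?thesis by (simp add: invariant_norm_def norm_act_def fun_eq_iff)
qed

lemma dist_scaled_sup_norm_le: "d_inf \<alpha> (\<lambda>v. exp (- D / 2) * sup_norm v) \<le> ennreal (D / 2)"
proof (subst d_inf_le_iff)
  have half: "exp (- D / 2) * exp D = exp (D / 2)" "exp (D / 2) * exp (- D / 2) = 1"
    by (simp_all flip: exp_add)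
  have "\<alpha> v \<le> exp (D / 2) * (exp (- D / 2) * sup_norm v)" for v
    using sup_norm_between(1)[of v] by (simp only: half mult_1 flip: mult.assoc)
  moreover have "exp (- D / 2) * sup_norm v \<le> exp (D / 2) * \<alpha> v" for v
  proof -
    have "exp (- D / 2) * sup_norm v \<le> exp (- D / 2) * (exp D * \<alpha> v)"
      by (intro mult_left_mono sup_norm_between) simp
    then show ?thesis by (simp only: half flip: mult.assoc)
  qed
  ultimately show "\<forall>v. v \<noteq> 0 \<longrightarrow> \<alpha> v \<le> exp (D / 2) * (exp (- D / 2) * sup_norm v) \<and>
      exp (- D / 2) * sup_norm v \<le> exp (D / 2) * \<alpha> v"
    by blast
qed (use norm is_norm_sup_norm D_nonneg in \<open>auto intro!: mult_pos_pos intro: is_norm_pos\<close>)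

lemma sup_norm_mem_component: "sup_norm \<in> norm_component absE scl \<alpha>"
proof -
  have "sup_norm v \<le> exp D * \<alpha> v \<and> \<alpha> v \<le> exp D * sup_norm v" for v
  proof -
    have "1 * sup_norm v \<le> exp D * sup_norm v"
      using D_nonneg is_norm_sup_norm by (intro mult_right_mono) (auto simp: is_norm_def)
    then show ?thesis using sup_norm_between[of v] by simp
  qed
  then have "d_inf sup_norm \<alpha> \<le> ennreal D"
    using norm is_norm_sup_norm D_nonneg by (subst d_inf_le_iff) (auto intro: is_norm_pos)
  then show ?thesis
    using is_norm_sup_norm by (auto simp: norm_component_def intro: le_less_trans)
qed

lemma scaled_sup_norm_mem_component:
  "(\<lambda>v. exp (- D / 2) * sup_norm v) \<in> norm_component absE scl \<alpha>"
proof -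
  have N: "is_norm absE scl (\<lambda>v. exp (- D / 2) * sup_norm v)"
    by (rule is_norm_scaled[OF is_norm_sup_norm]) simp
  then have "d_inf (\<lambda>v. exp (- D / 2) * sup_norm v) \<alpha> \<le> ennreal (D / 2)"
    using dist_scaled_sup_norm_le norm
    by (subst d_inf_commute[OF is_norm_pos[OF N] is_norm_pos[OF norm]])
  with N show ?thesis by (auto simp: norm_component_def intro: le_less_trans)
qed

lemma half_diameter_le_dist_invariant:
  assumes "\<beta> \<in> norm_component absE scl \<alpha>" "invariant_norm G act \<beta>"
  shows "ennreal (D / 2) \<le> d_inf \<alpha> \<beta>"
proof (cases "d_inf \<alpha> \<beta>" rule: ennreal_cases)
  case (real r)
  have "is_norm absE scl \<beta>" using assms by (simp add: norm_component_def)
  then have "ennreal D \<le> d_inf \<alpha> \<beta> + d_inf \<alpha> \<beta>"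
    using assms(2) by (intro orbit_diameter_le_twice_dist_invariant is_norm_pos)
  then have "D \<le> r + r" using real by (simp flip: ennreal_plus)
  then show ?thesis using real by (simp add: ennreal_leI)
qed simp

end


section \<open>The nearest invariant norm\<close>

theorem theorem5p3:
  fixes p :: nat
    and absQ :: "'q::field_char_0 \<Rightarrow> real"
    and hF :: "'q \<Rightarrow> 'f::field" and absF :: "'f \<Rightarrow> real"
    and hE :: "'q \<Rightarrow> 'e::field" and absE :: "'e \<Rightarrow> real"
    and S :: "('n::finite \<times> 'n, 'f) mvpoly set" and G :: "('f^'n^'n) set"
    and scaleP :: "'e \<Rightarrow> 'p::ab_group_add \<Rightarrow> 'p" and actP :: "'f^'n^'n \<Rightarrow> 'p \<Rightarrow> 'p"
    and scaleS :: "'e \<Rightarrow> 's::ab_group_add \<Rightarrow> 's" and actS :: "'f^'n^'n \<Rightarrow> 's \<Rightarrow> 's"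
    and scaleV :: "'e \<Rightarrow> 'v::ab_group_add \<Rightarrow> 'v" and actV :: "'f^'n^'n \<Rightarrow> 'v \<Rightarrow> 'v"
    and tens :: "'p \<Rightarrow> 's \<Rightarrow> 'v"
    and \<alpha>\<^sub>0 \<alpha>\<^sub>G \<alpha>\<^sub>s :: "'v \<Rightarrow> real" and D :: ennreal and NG :: "('v \<Rightarrow> real) set"
  assumes Qp: "is_padic_field p absQ"
    and F: "finite_extension hF"
    and absF: "nonarch_abs absF" "\<And>c. absF (hF c) = absQ c"
    and E: "finite_extension hE"
    and absE: "nonarch_abs absE" "nontrivial_abs absE"
    and reductive: "reductive_group S"
    and G: "G = rational_points S"
    and P: "vector_space scaleP" "is_representation G scaleP actP"
    and smooth: "smooth_representation (subtopology (matrix_topology absF) G) actP"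
    and admissible:
      "admissible_representation (subtopology (matrix_topology absF) G) scaleP actP"
    and S: "vector_space scaleS" "algebraic_representation hF hE S scaleS actS"
    and V: "vector_space scaleV" "is_tensor_product scaleP scaleS scaleV tens"
      "is_diagonal_action G scaleV tens actP actS actV"
    and \<alpha>\<^sub>0: "is_norm absE scaleV \<alpha>\<^sub>0"
    and D: "D = (SUP g\<in>G. d_inf \<alpha>\<^sub>0 (norm_act actV g \<alpha>\<^sub>0))"
    and bounded: "D < \<infinity>"
    and \<alpha>\<^sub>G: "\<alpha>\<^sub>G = (\<lambda>v. SUP g\<in>G. \<alpha>\<^sub>0 (actV (matrix_inv g) v))"
    and \<alpha>\<^sub>s: "\<alpha>\<^sub>s = (\<lambda>v. exp (- enn2real D / 2) * \<alpha>\<^sub>G v)"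
    and NG: "NG = {\<beta> \<in> norm_component absE scaleV \<alpha>\<^sub>0. invariant_norm G actV \<beta>}"
  shows "(SUP g\<in>G. SUP h\<in>G. d_inf (norm_act actV g \<alpha>\<^sub>0) (norm_act actV h \<alpha>\<^sub>0)) = D
    \<and> \<alpha>\<^sub>G \<in> NG
    \<and> \<alpha>\<^sub>s \<in> NG
    \<and> (INF \<beta>\<in>NG. d_inf \<alpha>\<^sub>0 \<beta>) = d_inf \<alpha>\<^sub>0 \<alpha>\<^sub>s
    \<and> d_inf \<alpha>\<^sub>0 \<alpha>\<^sub>s = D / 2"
proof -
  have group: "matrix_group G"
    using reductive unfolding G reductive_group_def Let_def
    by (elim conjE, intro matrix_group_rational_points)
  have "is_representation G scaleS actS"
    using S(2) unfolding algebraic_representation_def G by (rule conjunct1)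
  then have "is_representation G scaleV actV"
    by (rule is_representation_diagonal[OF P(2) _ V group])
  then interpret N: norm_with_bounded_orbit absE scaleV G actV \<alpha>\<^sub>0
    using absE(1) V(1) group \<alpha>\<^sub>0 bounded unfolding D by (intro norm_with_bounded_orbit.intro)
  have D': "D = ennreal N.D" by (simp add: N.ennreal_D D)
  have G': "\<alpha>\<^sub>G = N.sup_norm" by (simp add: \<alpha>\<^sub>G N.sup_norm_def fun_eq_iff)
  have s': "\<alpha>\<^sub>s = (\<lambda>v. exp (- N.D / 2) * N.sup_norm v)"
    by (simp add: \<alpha>\<^sub>s G' D' N.D_nonneg)
  have half: "D / 2 = ennreal (N.D / 2)"
    using N.D_nonneg by (simp add: D' ennreal_divide_numeral)
  have mem: "\<alpha>\<^sub>G \<in> NG" "\<alpha>\<^sub>s \<in> NG"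
    unfolding NG G' s'
    using N.sup_norm_mem_component N.scaled_sup_norm_mem_component
      N.invariant_norm_sup_norm invariant_norm_scaled[OF N.invariant_norm_sup_norm] by blast+
  have lower: "D / 2 \<le> d_inf \<alpha>\<^sub>0 \<beta>" if "\<beta> \<in> NG" for \<beta>
    using that by (simp add: half NG N.half_diameter_le_dist_invariant)
  have eq: "d_inf \<alpha>\<^sub>0 \<alpha>\<^sub>s = D / 2"
    using lower[OF mem(2)] N.dist_scaled_sup_norm_le by (intro antisym) (simp_all add: half s')
  have "(INF \<beta>\<in>NG. d_inf \<alpha>\<^sub>0 \<beta>) = d_inf \<alpha>\<^sub>0 \<alpha>\<^sub>s"
    using mem(2) lower by (intro antisym INF_lower[of \<alpha>\<^sub>s] INF_greatest) (simp_all add: eq)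
  with mem eq show ?thesis by (simp add: N.orbit_diameter D')
qed

end
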